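(* Fix a function $g : \omega \to \omega$, $n,\ell \ge 1$, and $k\in\omega$. Let $f : [\omega]^n \to k$ be a computable coloring such that every infinite set $H$ with $|f[H]^n| \leq \ell$ computes a function dominating $g$. Then for every infinite set $H$ with $|f[H]^n| \leq \ell$, the principal function $p_H$ is a domination modulus for $g$.
   Context: $[X]^n$ denotes the set of $n$-element subsets of $X$. A function $h$ dominates a function $f$ if $h(x) \geq f(x)$ for every $x$. The principal function of an infinite set $H = \{x_0 < x_1 < \dots\}$ is $p_H(n) = x_n$. A function $\nu : \omega \to \omega$ is a domination modulus for $g$ if every function dominating $\nu$ computes a function dominating $g$. *)

theory Defs
  imports "HOL-Library.Ramsey" "HOL-Library.Infinite_Set" "HOL-Library.Nat_Bijection"
    "HOL-Library.Indicator_Function"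
begin

(* Binary partial functions are coded as unary ones on Cantor pairs, prod_encode (a, m).
   Both schemes below are strict: the value is undefined as soon as an evaluation
   they need is undefined. *)

fun prim_rec :: "(nat \<rightharpoonup> nat) \<Rightarrow> (nat \<rightharpoonup> nat) \<Rightarrow> nat \<Rightarrow> nat \<Rightarrow> nat option" where
  "prim_rec F G a 0 = F a"
| "prim_rec F G a (Suc m) =
     Option.bind (prim_rec F G a m) (\<lambda>v. G (prod_encode (a, prod_encode (m, v))))"

(* Unbounded search for the least zero m of F (a, _); F (a, j) must be defined for all j < m. *)
definition minimization :: "(nat \<rightharpoonup> nat) \<Rightarrow> nat \<rightharpoonup> nat" where
  "minimization F a =
     (if \<exists>m. F (prod_encode (a, m)) = Some 0 \<and> (\<forall>j<m. F (prod_encode (a, j)) \<noteq> None)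
      then Some (LEAST m. F (prod_encode (a, m)) = Some 0)
      else None)"

(* The partial functions that are partial recursive relative to the oracle A (Kleene's schemes,
   with tuples coded by the Cantor pairing). *)
inductive partial_recursive_in :: "(nat \<Rightarrow> nat) \<Rightarrow> (nat \<rightharpoonup> nat) \<Rightarrow> bool" for A where
  zero: "partial_recursive_in A (\<lambda>x. Some 0)"
| succ: "partial_recursive_in A (\<lambda>x. Some (Suc x))"
| left: "partial_recursive_in A (\<lambda>x. Some (fst (prod_decode x)))"
| right: "partial_recursive_in A (\<lambda>x. Some (snd (prod_decode x)))"
| query: "partial_recursive_in A (\<lambda>x. Some (A x))"
| pair: "partial_recursive_in A F \<Longrightarrow> partial_recursive_in A G \<Longrightarrow>
    partial_recursive_in A
      (\<lambda>x. Option.bind (F x) (\<lambda>a. Option.bind (G x) (\<lambda>b. Some (prod_encode (a, b)))))"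
| comp: "partial_recursive_in A F \<Longrightarrow> partial_recursive_in A G \<Longrightarrow>
    partial_recursive_in A (\<lambda>x. Option.bind (G x) F)"
| rec: "partial_recursive_in A F \<Longrightarrow> partial_recursive_in A G \<Longrightarrow>
    partial_recursive_in A (\<lambda>x. prim_rec F G (fst (prod_decode x)) (snd (prod_decode x)))"
| mu: "partial_recursive_in A F \<Longrightarrow> partial_recursive_in A (minimization F)"

definition computes :: "(nat \<Rightarrow> nat) \<Rightarrow> (nat \<Rightarrow> nat) \<Rightarrow> bool" where
  "computes A u \<longleftrightarrow> partial_recursive_in A (\<lambda>x. Some (u x))"

(* Sets are identified with their characteristic functions. *)
definition set_computes :: "nat set \<Rightarrow> (nat \<Rightarrow> nat) \<Rightarrow> bool" where
  "set_computes H u \<longleftrightarrow> computes (indicator H) u"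

(* The constant zero oracle carries no information. *)
definition computable :: "(nat \<Rightarrow> nat) \<Rightarrow> bool" where
  "computable u \<longleftrightarrow> computes (\<lambda>x. 0) u"

(* An n-element set s is presented to an algorithm by its canonical index set_encode s,
   the sum of 2 ^ x over all x in s. *)
definition computable_coloring :: "nat \<Rightarrow> nat \<Rightarrow> (nat set \<Rightarrow> nat) \<Rightarrow> bool" where
  "computable_coloring n k f \<longleftrightarrow>
     f \<in> [UNIV]\<^bsup>n\<^esup> \<rightarrow> {..<k} \<and>
     (\<exists>r. computable r \<and> (\<forall>s\<in>[UNIV]\<^bsup>n\<^esup>. f s = r (set_encode s)))"

definition dominates :: "(nat \<Rightarrow> nat) \<Rightarrow> (nat \<Rightarrow> nat) \<Rightarrow> bool" where
  "dominates h u \<longleftrightarrow> (\<forall>x. h x \<ge> u x)"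

definition domination_modulus :: "(nat \<Rightarrow> nat) \<Rightarrow> (nat \<Rightarrow> nat) \<Rightarrow> bool" where
  "domination_modulus \<nu> g \<longleftrightarrow>
     (\<forall>h. dominates h \<nu> \<longrightarrow> (\<exists>u. computes h u \<and> dominates u g))"

(* enumerate H n is the n-th element of the infinite set H, counting from 0. *)
definition principal_function :: "nat set \<Rightarrow> nat \<Rightarrow> nat" where
  "principal_function H = enumerate H"

end

theory Submission
  imports Defs "HOL-Library.Countable"
begin

text \<open>The infinite sets \<open>X\<close> with \<open>f ` [X]\<^bsup>n\<^esup> \<subseteq> f ` [H]\<^bsup>n\<^esup>\<close> whose principal function is dominated by \<open>h\<close> are
  the paths of an \<open>h\<close>-decidable binary tree, and \<open>H\<close> is one of them. As in the hyperimmune-free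
  basis theorem, the tree is thinned out once for each program \<open>t\<close>: either some path makes \<open>t\<close>
  diverge at some input, and the tree is restricted to such paths, or \<open>t\<close> is total on all paths,
  and by compactness \<open>h\<close> computes a bound for its outputs on all of them. If no function computed by
  \<open>h\<close> dominated \<open>g\<close>, a common path would therefore compute no function dominating \<open>g\<close>,
  contrary to the hypothesis.\<close>

section \<open>Total functions computable in an oracle\<close>

named_theorems computes_intros

definition decides :: "(nat \<Rightarrow> nat) \<Rightarrow> (nat \<Rightarrow> bool) \<Rightarrow> bool" where
  "decides A P \<longleftrightarrow> computes A (\<lambda>x. of_bool (P x))"

lemma computes_comp:
  assumes "computes A F" and "computes A G"
  shows "computes A (\<lambda>x. F (G x))"
  using partial_recursive_in.comp[OF assms[unfolded computes_def]] by (simp add: computes_def)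

lemma decides_comp: "decides A P \<Longrightarrow> computes A G \<Longrightarrow> decides A (\<lambda>x. P (G x))"
  unfolding decides_def by (rule computes_comp)

lemma computes_prod_encode [computes_intros]:
  assumes "computes A F" and "computes A G"
  shows "computes A (\<lambda>x. prod_encode (F x, G x))"
  using partial_recursive_in.pair[OF assms[unfolded computes_def]] by (simp add: computes_def)

lemma computes_Suc [computes_intros]: "computes A F \<Longrightarrow> computes A (\<lambda>x. Suc (F x))"
  using computes_comp[of A Suc F] partial_recursive_in.succ by (simp add: computes_def)

lemma computes_fst [computes_intros]:
  "computes A F \<Longrightarrow> computes A (\<lambda>x. fst (prod_decode (F x)))"
  using computes_comp[of A "\<lambda>x. fst (prod_decode x)" F] partial_recursive_in.left
  by (simp add: computes_def)

lemma computes_snd [computes_intros]: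
  "computes A F \<Longrightarrow> computes A (\<lambda>x. snd (prod_decode (F x)))"
  using computes_comp[of A "\<lambda>x. snd (prod_decode x)" F] partial_recursive_in.right
  by (simp add: computes_def)

lemma computes_query: "computes A F \<Longrightarrow> computes A (\<lambda>x. A (F x))"
  using computes_comp[of A A F] partial_recursive_in.query by (simp add: computes_def)

lemma computes_id [computes_intros]: "computes A (\<lambda>x. x)"
  using computes_prod_encode[of A "\<lambda>x. fst (prod_decode x)" "\<lambda>x. snd (prod_decode x)"]
    partial_recursive_in.left partial_recursive_in.right by (simp add: computes_def)

lemma computes_const [computes_intros]: "computes A (\<lambda>x. c)"
proof (induction c)
  case 0
  show ?case by (simp add: computes_def partial_recursive_in.zero)
qed (rule computes_Suc)

text \<open>The step function has three arguments (parameter, counter, previous value), so its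
  computability is stated for the unary function that reads them off a nested Cantor pair.
  Arithmetic, bounded sums and, through these, bounded quantifiers are reduced to this rule.\<close>

lemma computes_rec_nat [computes_intros]:
  assumes B: "computes A B"
    and S: "computes A (\<lambda>z. S (fst (prod_decode z)) (fst (prod_decode (snd (prod_decode z))))
                            (snd (prod_decode (snd (prod_decode z)))))"
    and N: "computes A N"
  shows "computes A (\<lambda>x. rec_nat (B x) (S x) (N x))"
proof -
  let ?S = "\<lambda>z. Some (S (fst (prod_decode z)) (fst (prod_decode (snd (prod_decode z))))
                            (snd (prod_decode (snd (prod_decode z)))))"
  have *: "prim_rec (\<lambda>x. Some (B x)) ?S a m = Some (rec_nat (B a) (S a) m)" for a m
    by (induction m) auto
  have "computes A (\<lambda>x. rec_nat (B (fst (prod_decode x))) (S (fst (prod_decode x)))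
                          (snd (prod_decode x)))"
    using partial_recursive_in.rec[OF B[unfolded computes_def] S[unfolded computes_def]]
    by (simp add: * computes_def)
  from computes_comp[OF this computes_prod_encode[OF computes_id N]] show ?thesis by simp
qed

lemma computes_of_bool [computes_intros]: "decides A P \<Longrightarrow> computes A (\<lambda>x. of_bool (P x))"
  by (simp add: decides_def)

lemma computes_if [computes_intros]:
  assumes "decides A P" "computes A F" "computes A G"
  shows "computes A (\<lambda>x. if P x then F x else G x)"
proof -
  \<comment> \<open>A case distinction is a recursion of length 0 or 1, governed by the truth value
    of \<open>P x\<close>.\<close>
  have "computes A (\<lambda>x. rec_nat (G x) (\<lambda>_ _. F x) (of_bool (P x)))"
    by (intro computes_intros assms computes_comp[OF assms(2)])
  moreover have "rec_nat (G x) (\<lambda>_ _. F x) (of_bool (P x)) = (if P x then F x else G x)" for x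
    by simp
  ultimately show ?thesis by simp
qed

lemma computes_pred [computes_intros]:
  assumes "computes A F"
  shows "computes A (\<lambda>x. F x - 1)"
proof -
  have "computes A (\<lambda>x. rec_nat 0 (\<lambda>m _. m) (F x))"
    by (intro computes_intros assms)
  moreover have "rec_nat 0 (\<lambda>m _. m) y = y - 1" for y :: nat
    by (cases y) auto
  ultimately show ?thesis by simp
qed

lemma computes_diff [computes_intros]:
  assumes "computes A F" "computes A G"
  shows "computes A (\<lambda>x. F x - G x)"
proof -
  have "computes A (\<lambda>x. rec_nat (F x) (\<lambda>_ v. v - 1) (G x))"
    by (intro computes_intros assms)
  moreover have "rec_nat a (\<lambda>_ v. v - 1) b = a - b" for a b :: nat
    by (induction b) auto
  ultimately show ?thesis by simp
qed

lemma computes_add [computes_intros]: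
  assumes "computes A F" "computes A G"
  shows "computes A (\<lambda>x. F x + G x)"
proof -
  have "computes A (\<lambda>x. rec_nat (F x) (\<lambda>_ v. Suc v) (G x))"
    by (intro computes_intros assms)
  moreover have "rec_nat a (\<lambda>_ v. Suc v) b = a + b" for a b :: nat
    by (induction b) auto
  ultimately show ?thesis by simp
qed

lemma computes_power2 [computes_intros]:
  assumes "computes A F"
  shows "computes A (\<lambda>x. 2 ^ F x)"
proof -
  have "computes A (\<lambda>x. rec_nat 1 (\<lambda>_ v. v + v) (F x))"
    by (intro computes_intros assms)
  moreover have "rec_nat 1 (\<lambda>_ v. v + v) b = (2 ^ b :: nat)" for b :: nat
    by (induction b) auto
  ultimately show ?thesis by simp
qed

lemma computes_sum [computes_intros]:
  assumes "computes A (\<lambda>z. F (fst (prod_decode z)) (snd (prod_decode z)))" "computes A N"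
  shows "computes A (\<lambda>x. \<Sum>i<N x. F x i)"
proof -
  have F: "computes A (\<lambda>z. F (a z) (b z))" if "computes A a" "computes A b" for a b
    using computes_comp[OF assms(1) computes_prod_encode[OF that]] by simp
  have "computes A (\<lambda>x. rec_nat 0 (\<lambda>i v. v + F x i) (N x))"
    by (intro computes_intros F assms)
  moreover have "rec_nat 0 (\<lambda>i v. v + F x i) b = (\<Sum>i<b. F x i)" for x b
    by (induction b) auto
  ultimately show ?thesis by simp
qed

section \<open>Decidable predicates, bounded quantifiers and search\<close>

lemma decides_eq_0:
  assumes "computes A F"
  shows "decides A (\<lambda>x. F x = 0)"
proof -
  have "computes A (\<lambda>x. 1 - F x)"
    by (intro computes_intros assms)
  moreover have "1 - y = of_bool (y = 0)" for y :: nat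
    by simp
  ultimately show ?thesis by (simp add: decides_def)
qed

lemma decides_not [computes_intros]:
  assumes "decides A P"
  shows "decides A (\<lambda>x. \<not> P x)"
  using decides_eq_0[OF computes_of_bool[OF assms]] by simp

lemma decides_conj [computes_intros]:
  assumes "decides A P" "decides A Q"
  shows "decides A (\<lambda>x. P x \<and> Q x)"
proof -
  have "computes A (\<lambda>x. if P x then of_bool (Q x) else 0)"
    by (intro computes_intros assms)
  moreover have "(if P x then of_bool (Q x) else 0) = (of_bool (P x \<and> Q x) :: nat)" for x
    by simp
  ultimately show ?thesis by (simp only: decides_def)
qed

lemma decides_imp [computes_intros]:
  assumes "decides A P" "decides A Q"
  shows "decides A (\<lambda>x. P x \<longrightarrow> Q x)"
proof -
  have "decides A (\<lambda>x. \<not> (P x \<and> \<not> Q x))"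
    by (intro computes_intros assms)
  then show ?thesis by simp
qed

lemma decides_disj [computes_intros]:
  assumes "decides A P" "decides A Q"
  shows "decides A (\<lambda>x. P x \<or> Q x)"
proof -
  have "decides A (\<lambda>x. \<not> P x \<longrightarrow> Q x)"
    by (intro computes_intros assms)
  then show ?thesis by (simp add: disj_imp)
qed

lemma decides_less [computes_intros]:
  assumes "computes A F" "computes A G"
  shows "decides A (\<lambda>x. F x < G x)"
proof -
  have "decides A (\<lambda>x. \<not> G x - F x = 0)"
    by (intro computes_intros decides_eq_0 assms)
  then show ?thesis by (simp add: not_le)
qed

lemma decides_le [computes_intros]:
  assumes "computes A F" "computes A G"
  shows "decides A (\<lambda>x. F x \<le> G x)"
  using decides_eq_0[OF computes_diff[OF assms]] by simp

lemma decides_eq [computes_intros]: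
  assumes "computes A F" "computes A G"
  shows "decides A (\<lambda>x. F x = G x)"
  using decides_conj[OF decides_le[OF assms] decides_le[OF assms(2,1)]]
  by (simp add: eq_iff)

lemma decides_all_less [computes_intros]:
  assumes "decides A (\<lambda>z. P (fst (prod_decode z)) (snd (prod_decode z)))" "computes A N"
  shows "decides A (\<lambda>x. \<forall>i<N x. P x i)"
proof -
  \<comment> \<open>A bounded universal statement holds when the number of its counterexamples is
    zero.\<close>
  have "decides A (\<lambda>x. (\<Sum>i<N x. of_bool (\<not> P x i)) = (0::nat))"
    by (intro computes_intros assms)
  moreover have "(\<Sum>i<N x. of_bool (\<not> P x i)) = (0::nat) \<longleftrightarrow> (\<forall>i<N x. P x i)" for x
    by auto
  ultimately show ?thesis by (simp only:)
qed

lemma decides_ex_less [computes_intros]: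
  assumes "decides A (\<lambda>z. P (fst (prod_decode z)) (snd (prod_decode z)))" "computes A N"
  shows "decides A (\<lambda>x. \<exists>i<N x. P x i)"
proof -
  have "decides A (\<lambda>x. \<not> (\<forall>i<N x. \<not> P x i))"
    by (intro computes_intros assms)
  then show ?thesis by simp
qed

text \<open>The finite set is built into the program, with one equality test per element.\<close>

lemma decides_mem_finite:
  assumes "finite C" and F: "computes A F"
  shows "decides A (\<lambda>x. F x \<in> C)"
  using assms(1)
proof (induction C)
  case empty
  have "decides A (\<lambda>x. Suc 0 = 0)"
    by (intro computes_intros)
  then show ?case by simp
next
  case (insert c C)
  have "decides A (\<lambda>x. F x = c \<or> F x \<in> C)"
    by (intro computes_intros F insert.IH)
  then show ?case by simp
qed

lemma decides_odd [computes_intros]: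
  assumes "computes A F"
  shows "decides A (\<lambda>x. odd (F x))"
proof -
  have "computes A (\<lambda>x. rec_nat 0 (\<lambda>_ v. 1 - v) (F x))"
    by (intro computes_intros assms)
  moreover have "rec_nat 0 (\<lambda>_ v. 1 - v) y = (of_bool (odd y) :: nat)" for y
    by (induction y) auto
  ultimately show ?thesis by (simp add: decides_def)
qed

lemma decides_set_decode [computes_intros]:
  assumes "computes A F" "computes A D"
  shows "decides A (\<lambda>x. F x \<in> set_decode (D x))"
proof -
  \<comment> \<open>Halving is obtained by counting the odd numbers below \<open>v\<close>.\<close>
  have half: "(\<Sum>i<v. of_bool (odd i)) = v div 2" for v :: nat
    by (induction v) (auto elim!: oddE evenE)
  have "decides A (\<lambda>x. odd (rec_nat (D x) (\<lambda>_ v. \<Sum>i<v. of_bool (odd i)) (F x)))"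
    by (intro computes_intros assms)
  moreover have "rec_nat d (\<lambda>_ v. v div 2) y = d div 2 ^ y" for d y :: nat
    by (induction y) (simp_all add: mult.commute flip: div_mult2_eq)
  ultimately show ?thesis by (simp add: half set_decode_def)
qed

text \<open>\<open>minimization\<close> looks for a zero, hence the negated truth value of
  \<open>P\<close>. This is total, so the definedness clause holds trivially, and \<open>ex\<close>
  makes every search end.\<close>

lemma computes_Least:
  assumes "decides A (\<lambda>z. P (fst (prod_decode z)) (snd (prod_decode z)))"
    and ex: "\<And>x. \<exists>m. P x m" and F: "computes A F"
  shows "computes A (\<lambda>x. LEAST m. P (F x) m)"
proof -
  let ?P = "\<lambda>z. of_bool (\<not> P (fst (prod_decode z)) (snd (prod_decode z))) :: nat"
  have "computes A ?P"
    by (intro computes_intros assms)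
  moreover have "minimization (\<lambda>z. Some (?P z)) = (\<lambda>x. Some (LEAST m. P x m))"
    using ex by (auto simp: minimization_def fun_eq_iff)
  ultimately have "computes A (\<lambda>x. LEAST m. P x m)"
    using partial_recursive_in.mu[of A "\<lambda>z. Some (?P z)"] by (simp only: computes_def)
  from computes_comp[OF this F] show ?thesis .
qed

text \<open>Queries to the zero oracle are replaced by the constant zero, and the other schemes
  carry over. This brings the computable coloring into computations from \<open>h\<close>.\<close>

lemma computes_mono:
  assumes "computes (\<lambda>x. 0) u"
  shows "computes A u"
proof -
  have "partial_recursive_in B F \<Longrightarrow> B = (\<lambda>x. 0) \<Longrightarrow> partial_recursive_in A F" for B F
    by (induction rule: partial_recursive_in.induct) (auto intro: partial_recursive_in.intros)
  then show ?thesis using assms by (simp add: computes_def)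
qed

section \<open>Canonical indices of finite sets\<close>

lemma power_le_of_mem_set_decode: "i \<in> set_decode d \<Longrightarrow> 2 ^ i \<le> d"
  by (rule ccontr) (simp add: set_decode_def not_le)

lemma less_of_mem_set_decode: "i \<in> set_decode d \<Longrightarrow> i < d"
  using power_le_of_mem_set_decode less_exp order_less_le_trans by blast

text \<open>Together with \<open>set_encode_less\<close> this turns quantification over the subsets
  of \<open>{..<m}\<close> into a bounded quantifier over indices below
  \<open>2 ^ m\<close>.\<close>

lemma set_decode_subset_lessThan: "d < 2 ^ m \<Longrightarrow> set_decode d \<subseteq> {..<m}"
  using power_le_of_mem_set_decode
  by (metis lessThan_iff order_le_less_trans one_less_numeral_iff power_less_imp_less_exp
      semiring_norm(76) subsetI)

lemma set_encode_less:
  assumes "D \<subseteq> {..<m}"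
  shows "set_encode D < 2 ^ m"
proof -
  have "set_encode D \<le> set_encode {..<m}"
    unfolding set_encode_def by (rule sum_mono2) (use assms in auto)
  also have "\<dots> < 2 ^ m"
    unfolding set_encode_def by (induction m) (auto simp: lessThan_Suc)
  finally show ?thesis .
qed

section \<open>Programs\<close>

text \<open>Syntax for the schemes lets the same program run on different oracles, and its
  countability lets all programs be treated one per stage.\<close>

datatype code = Zero | Succ | Left | Right | Query | Pair code code | Comp code code
  | Rec code code | Mu code

instance code :: countable
  by countable_datatype

definition search :: "nat set \<Rightarrow> (nat \<rightharpoonup> nat) \<Rightarrow> nat \<rightharpoonup> nat" where
  "search B F a =
     (if \<exists>m\<in>B. F (prod_encode (a, m)) = Some 0 \<and> (\<forall>j<m. F (prod_encode (a, j)) \<noteq> None)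
      then Some (LEAST m. F (prod_encode (a, m)) = Some 0)
      else None)"

text \<open>The oracle may be partial, and unbounded search succeeds only if it ends inside \<open>B\<close>. This
  covers both genuine computations and their finite approximations.\<close>

primrec run :: "(nat \<rightharpoonup> nat) \<Rightarrow> nat set \<Rightarrow> code \<Rightarrow> nat \<rightharpoonup> nat" where
  "run p B Zero = (\<lambda>x. Some 0)"
| "run p B Succ = (\<lambda>x. Some (Suc x))"
| "run p B Left = (\<lambda>x. Some (fst (prod_decode x)))"
| "run p B Right = (\<lambda>x. Some (snd (prod_decode x)))"
| "run p B Query = p"
| "run p B (Pair s t) =
     (\<lambda>x. Option.bind (run p B s x) (\<lambda>a. Option.bind (run p B t x) (\<lambda>b. Some (prod_encode (a, b)))))"
| "run p B (Comp s t) = (\<lambda>x. Option.bind (run p B t x) (run p B s))"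
| "run p B (Rec s t) =
     (\<lambda>x. prim_rec (run p B s) (run p B t) (fst (prod_decode x)) (snd (prod_decode x)))"
| "run p B (Mu t) = search B (run p B t)"

abbreviation full_run :: "nat set \<Rightarrow> code \<Rightarrow> nat \<rightharpoonup> nat" where
  "full_run X \<equiv> run (\<lambda>x. Some (indicator X x)) UNIV"

text \<open>In \<open>fuel_run\<close> the one number \<open>m\<close> limits both the known part of
  the oracle and the results of all searches. Primitive recursion has a prescribed length, so
  nothing else has to be limited.\<close>

definition finite_oracle :: "nat \<Rightarrow> nat set \<Rightarrow> nat \<rightharpoonup> nat" where
  "finite_oracle m D x = (if x < m then Some (indicator D x) else None)"

abbreviation fuel_run :: "nat \<Rightarrow> nat set \<Rightarrow> code \<Rightarrow> nat \<rightharpoonup> nat" where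
  "fuel_run m D \<equiv> run (finite_oracle m D) {..<m}"

lemma partial_recursive_in_imp_run:
  "partial_recursive_in A F \<Longrightarrow> \<exists>t. run (\<lambda>x. Some (A x)) UNIV t = F"
proof (induction rule: partial_recursive_in.induct)
  case zero
  show ?case by (rule exI[of _ Zero]) simp
next
  case succ
  show ?case by (rule exI[of _ Succ]) simp
next
  case left
  show ?case by (rule exI[of _ Left]) simp
next
  case right
  show ?case by (rule exI[of _ Right]) simp
next
  case query
  show ?case by (rule exI[of _ Query]) simp
next
  case (pair F G)
  then obtain s t where "run (\<lambda>x. Some (A x)) UNIV s = F" "run (\<lambda>x. Some (A x)) UNIV t = G"
    by blast
  then show ?case by (intro exI[of _ "Pair s t"]) simp
next
  case (comp F G)
  then obtain s t where "run (\<lambda>x. Some (A x)) UNIV s = F" "run (\<lambda>x. Some (A x)) UNIV t = G"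
    by blast
  then show ?case by (intro exI[of _ "Comp s t"]) simp
next
  case (rec F G)
  then obtain s t where "run (\<lambda>x. Some (A x)) UNIV s = F" "run (\<lambda>x. Some (A x)) UNIV t = G"
    by blast
  then show ?case by (intro exI[of _ "Rec s t"]) simp
next
  case (mu F)
  then obtain t where "run (\<lambda>x. Some (A x)) UNIV t = F"
    by blast
  then show ?case by (intro exI[of _ "Mu t"]) (auto simp: search_def minimization_def fun_eq_iff)
qed

text \<open>The right-hand side only asserts that certain values are present, so it persists when
  \<open>F\<close> is extended, which the definition does not show. Downward closure of
  \<open>B\<close> is what places the least zero in \<open>B\<close> once some admissible zero lies
  there.\<close>

lemma search_eq_Some_iff:
  assumes B: "\<forall>j\<in>B. {..j} \<subseteq> B"
  shows "search B F a = Some m \<longleftrightarrow> m \<in> B \<and> F (prod_encode (a, m)) = Some 0 \<and>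
     (\<forall>j<m. \<exists>v. F (prod_encode (a, j)) = Some (Suc v))"
proof -
  let ?F = "\<lambda>m. F (prod_encode (a, m))"
  let ?R = "\<lambda>m. m \<in> B \<and> ?F m = Some 0 \<and> (\<forall>j<m. \<exists>v. ?F j = Some (Suc v))"
  have least: "(LEAST m. ?F m = Some 0) = m" if "?R m" for m
  proof (rule Least_equality)
    show "m \<le> y" if "?F y = Some 0" for y
    proof (rule ccontr)
      assume "\<not> m \<le> y"
      then have "\<exists>v. ?F y = Some (Suc v)" using \<open>?R m\<close> by simp
      with that show False by simp
    qed
  qed (use that in blast)
  have "?R (LEAST m. ?F m = Some 0)"
    if m: "m \<in> B" "?F m = Some 0" "\<forall>j<m. ?F j \<noteq> None" for m
  proof (intro conjI allI impI)
    have le: "(LEAST m. ?F m = Some 0) \<le> m" using m(2) by (rule Least_le)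
    then show "(LEAST m. ?F m = Some 0) \<in> B" using B m(1) by auto
    show "?F (LEAST m. ?F m = Some 0) = Some 0" using m(2) by (rule LeastI)
    fix j assume j: "j < (LEAST m. ?F m = Some 0)"
    then obtain w where "?F j = Some w" using m(3) le by fastforce
    then show "\<exists>v. ?F j = Some (Suc v)" using not_less_Least[OF j] by (cases w) auto
  qed
  then have LEAST: "?R (LEAST m. ?F m = Some 0)" if "\<exists>m\<in>B. ?F m = Some 0 \<and> (\<forall>j<m. ?F j \<noteq> None)"
    using that by blast
  have ex: "\<exists>m\<in>B. ?F m = Some 0 \<and> (\<forall>j<m. ?F j \<noteq> None)" if "?R m"
  proof (intro bexI conjI allI impI)
    show "?F j \<noteq> None" if "j < m" for j using \<open>?R m\<close> that by force
  qed (use that in auto)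
  show ?thesis
  proof
    assume "search B F a = Some m"
    then show "?R m" using LEAST by (auto simp: search_def split: if_splits)
  next
    assume "?R m"
    with ex[OF this] least[OF this] show "search B F a = Some m" by (simp only: search_def if_True)
  qed
qed

section \<open>Approximating computations by finite levels\<close>

lemma prim_rec_mono:
  assumes "\<And>x v. F x = Some v \<Longrightarrow> F' x = Some v" "\<And>x v. G x = Some v \<Longrightarrow> G' x = Some v"
  shows "prim_rec F G a m = Some v \<Longrightarrow> prim_rec F' G' a m = Some v"
  by (induction m arbitrary: v) (auto simp: bind_eq_Some_conv assms)

lemma run_mono:
  assumes p: "\<And>x v. p x = Some v \<Longrightarrow> p' x = Some v" and "B \<subseteq> B'"
    and B: "\<forall>j\<in>B. {..j} \<subseteq> B" "\<forall>j\<in>B'. {..j} \<subseteq> B'"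
  shows "run p B t x = Some v \<Longrightarrow> run p' B' t x = Some v"
proof (induction t arbitrary: x v)
  case (Rec s t)
  then show ?case using prim_rec_mono[of "run p B s" "run p' B' s" "run p B t" "run p' B' t"]
    by simp
next
  case (Mu t)
  have "v \<in> B" "run p B t (prod_encode (x, v)) = Some 0"
    "\<forall>j<v. \<exists>w. run p B t (prod_encode (x, j)) = Some (Suc w)"
    using Mu.prems by (simp_all add: search_eq_Some_iff[OF B(1)])
  then show ?case
    unfolding run.simps search_eq_Some_iff[OF B(2)] using Mu.IH assms(2) by blast
qed (auto simp: bind_eq_Some_conv p)

lemma fuel_run_mono:
  assumes "fuel_run m D t x = Some v" "m \<le> m'" "D = D' \<inter> {..<m}"
  shows "fuel_run m' D' t x = Some v"
  using assms(1)
proof (rule run_mono[rotated 4])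
  show "finite_oracle m' D' x = Some v" if "finite_oracle m D x = Some v" for x v
    using that assms(2,3) by (auto simp: finite_oracle_def indicator_def split: if_splits)
qed (use assms(2) in auto)

lemma fuel_run_sound:
  assumes "fuel_run m (X \<inter> {..<m}) t x = Some v"
  shows "full_run X t x = Some v"
  using assms
proof (rule run_mono[rotated 4])
  show "Some (indicator X x) = Some v" if "finite_oracle m (X \<inter> {..<m}) x = Some v" for x v
    using that by (auto simp: finite_oracle_def indicator_def split: if_splits)
qed auto

text \<open>A convergent computation makes finitely many queries and search steps. Phrased with
  \<open>eventually\<close>, the bounds of finitely many subcomputations combine without explicit
  maxima.\<close>

lemma eventually_fuel_run:
  "full_run X t x = Some v \<Longrightarrow> \<forall>\<^sub>F m in sequentially. fuel_run m (X \<inter> {..<m}) t x = Some v"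
proof (induction t arbitrary: x v)
  case Query
  then show ?case
    by (auto simp: finite_oracle_def indicator_def intro: eventually_mono[OF eventually_gt_at_top[of x]])
next
  case (Pair s t)
  then obtain a b where "full_run X s x = Some a" "full_run X t x = Some b" "v = prod_encode (a, b)"
    by (auto simp: bind_eq_Some_conv)
  from Pair.IH(1)[OF this(1)] Pair.IH(2)[OF this(2)] this(3) show ?case
    by (auto elim: eventually_elim2)
next
  case (Comp s t)
  then obtain a where "full_run X t x = Some a" "full_run X s a = Some v"
    by (auto simp: bind_eq_Some_conv)
  from Comp.IH(2)[OF this(1)] Comp.IH(1)[OF this(2)] show ?case
    by (auto elim: eventually_elim2)
next
  case (Rec s t)
  have "prim_rec (full_run X s) (full_run X t) a n = Some v \<Longrightarrow> \<forall>\<^sub>F m in sequentially.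
      prim_rec (fuel_run m (X \<inter> {..<m}) s) (fuel_run m (X \<inter> {..<m}) t) a n = Some v" for a n v
  proof (induction n arbitrary: v)
    case 0
    then show ?case using Rec.IH(1) by simp
  next
    case (Suc n)
    then obtain w where "prim_rec (full_run X s) (full_run X t) a n = Some w"
      "full_run X t (prod_encode (a, prod_encode (n, w))) = Some v"
      by (auto simp: bind_eq_Some_conv)
    from Suc.IH[OF this(1)] Rec.IH(2)[OF this(2)] show ?case
      by (auto elim: eventually_elim2)
  qed
  then show ?case using Rec.prems by simp
next
  case (Mu t)
  have v: "full_run X t (prod_encode (x, v)) = Some 0"
    and "\<forall>j<v. \<exists>w. full_run X t (prod_encode (x, j)) = Some (Suc w)"
    using Mu.prems by (auto simp: search_eq_Some_iff)
  then obtain w where w: "full_run X t (prod_encode (x, j)) = Some (Suc (w j))" if "j < v" for j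
    by metis
  have "\<forall>\<^sub>F m in sequentially. \<forall>j\<in>{..<v}.
          fuel_run m (X \<inter> {..<m}) t (prod_encode (x, j)) = Some (Suc (w j))"
    using w by (intro eventually_ball_finite ballI Mu.IH) auto
  \<comment> \<open>The level must also exceed \<open>v\<close>, because a search counts only if its
    result lies in \<open>{..<m}\<close>.\<close>
  with Mu.IH[OF v] eventually_gt_at_top[of v] show ?case
    unfolding run.simps by eventually_elim (subst search_eq_Some_iff, auto)
qed auto

text \<open>\<open>computes\<close> speaks of total functions, so the possibly undefined outcome of
  a bounded run is turned into a number.\<close>

primrec opt_code :: "nat option \<Rightarrow> nat" where
  "opt_code None = 0"
| "opt_code (Some v) = Suc v"

lemma opt_code_eq_0_iff [simp]: "opt_code v = 0 \<longleftrightarrow> v = None"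
  by (cases v) auto

lemma opt_code_eq_Suc_iff: "opt_code v = Suc m \<longleftrightarrow> v = Some m"
  by (cases v) auto

lemma opt_code_bind:
  "opt_code (Option.bind v F) = (if opt_code v = 0 then 0 else opt_code (F (opt_code v - 1)))"
  by (cases v) auto

lemma opt_code_prim_rec:
  "opt_code (prim_rec F G a m) = rec_nat (opt_code (F a))
     (\<lambda>m v. if v = 0 then 0 else opt_code (G (prod_encode (a, prod_encode (m, v - 1))))) m"
  by (induction m) (simp_all add: opt_code_bind)

text \<open>The disjunct \<open>b \<le> m\<close> makes the search total, as
  \<open>computes_Least\<close> requires, and leaves its value unchanged when there is a zero below
  \<open>b\<close>.\<close>

lemma opt_code_search:
  "opt_code (search {..<b} F a) =
     (if \<exists>m<b. opt_code (F (prod_encode (a, m))) = Suc 0 \<and>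
               (\<forall>j<m. \<not> opt_code (F (prod_encode (a, j))) = 0)
      then Suc (LEAST m. opt_code (F (prod_encode (a, m))) = Suc 0 \<or> b \<le> m) else 0)"
proof -
  let ?Z = "\<lambda>m. F (prod_encode (a, m)) = Some 0"
  have "(LEAST m. ?Z m \<or> b \<le> m) = (LEAST m. ?Z m)" if "m < b" "?Z m" for m
  proof (rule Least_equality)
    show "?Z (LEAST m. ?Z m) \<or> b \<le> (LEAST m. ?Z m)" using LeastI[of ?Z, OF that(2)] by blast
    show "(LEAST m. ?Z m) \<le> y" if "?Z y \<or> b \<le> y" for y
      using that Least_le[of ?Z y] Least_le[of ?Z m] \<open>m < b\<close> \<open>?Z m\<close> by auto
  qed
  then show ?thesis by (auto simp: search_def opt_code_eq_Suc_iff)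
qed

text \<open>The program \<open>t\<close> is fixed and the induction follows its syntax. Level,
  oracle index and input are arbitrary computable functions, since subprograms are called at inputs
  that are themselves computed.\<close>

lemma computes_fuel_run [computes_intros]:
  assumes "computes A M" and "computes A D" and "computes A F"
  shows "computes A (\<lambda>z. opt_code (fuel_run (M z) (set_decode (D z)) t (F z)))"
  using assms
proof (induction t arbitrary: M D F)
  case Query
  have "computes A (\<lambda>z. if F z < M z then Suc (of_bool (F z \<in> set_decode (D z))) else 0)"
    by (intro computes_intros Query)
  moreover have "(if y < m then Suc (of_bool (y \<in> X)) else 0) = opt_code (fuel_run m X Query y)"
    for y m X
    by (simp add: finite_oracle_def indicator_def)
  ultimately show ?case by (simp only:)
next
  case (Mu t)
  \<comment> \<open>Level, oracle index and input are packed into the single parameter that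
    \<open>computes_Least\<close> offers.\<close>
  let ?P = "\<lambda>x m. opt_code (fuel_run (fst (prod_decode x))
      (set_decode (fst (prod_decode (snd (prod_decode x))))) t
      (prod_encode (snd (prod_decode (snd (prod_decode x))), m))) = Suc 0 \<or> fst (prod_decode x) \<le> m"
  have "decides A (\<lambda>z. ?P (fst (prod_decode z)) (snd (prod_decode z)))"
    by (intro computes_intros Mu.IH)
  moreover have "\<exists>m. ?P x m" for x by blast
  moreover have "computes A (\<lambda>z. prod_encode (M z, prod_encode (D z, F z)))"
    by (intro computes_intros Mu.prems)
  ultimately have "computes A (\<lambda>z. LEAST m. ?P (prod_encode (M z, prod_encode (D z, F z))) m)"
    by (rule computes_Least)
  then have least: "computes A (\<lambda>z. LEAST m. opt_code (fuel_run (M z) (set_decode (D z)) t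
      (prod_encode (F z, m))) = Suc 0 \<or> M z \<le> m)"
    by simp
  show ?case
    unfolding run.simps opt_code_search
    by (intro computes_intros least Mu computes_comp[OF Mu.prems(1)] computes_comp[OF Mu.prems(2)]
       computes_comp[OF Mu.prems(3)])
next
  case (Pair s t)
  show ?case
    unfolding run.simps opt_code_bind opt_code.simps
    by (intro computes_intros Pair)
next
  case (Comp s t)
  show ?case
    unfolding run.simps opt_code_bind
    by (intro computes_intros Comp)
next
  case (Rec s t)
  show ?case
    unfolding run.simps opt_code_prim_rec
    by (intro computes_intros Rec computes_comp[OF Rec.prems(1)] computes_comp[OF Rec.prems(2)]
       computes_comp[OF Rec.prems(3)])
qed (simp_all only: run.simps opt_code.simps, (intro computes_intros; assumption)+)

section \<open>Compactness\<close>

text \<open>A pair of \<open>m\<close> and \<open>D \<subseteq> {..<m}\<close> stands for a binary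
  string of length \<open>m\<close>, and intersecting with \<open>{..<m}\<close> truncates
  it.\<close>

definition is_tree :: "(nat \<Rightarrow> nat set \<Rightarrow> bool) \<Rightarrow> bool" where
  "is_tree Q \<longleftrightarrow> (\<forall>m m' D. m \<le> m' \<longrightarrow> Q m' D \<longrightarrow> Q m (D \<inter> {..<m}))"

lemma is_treeD: "is_tree Q \<Longrightarrow> m \<le> m' \<Longrightarrow> Q m' D \<Longrightarrow> Q m (D \<inter> {..<m})"
  unfolding is_tree_def by blast

definition paths :: "(nat \<Rightarrow> nat set \<Rightarrow> bool) \<Rightarrow> nat set set" where
  "paths Q = {X. \<forall>m. Q m (X \<inter> {..<m})}"

lemma koenig:
  assumes tree: "is_tree Q" and ex: "\<And>m. \<exists>D. D \<subseteq> {..<m} \<and> Q m D"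
  shows "paths Q \<noteq> {}"
proof -
  \<comment> \<open>These are the extendible nodes, which have extensions in \<open>Q\<close> at all
    levels from \<open>m\<close> on.\<close>
  define E where "E m D \<longleftrightarrow> D \<subseteq> {..<m} \<and> (\<forall>m'\<ge>m. \<exists>D'. D' \<inter> {..<m} = D \<and> Q m' D')" for m D
  have "\<exists>D'. E (Suc m) D' \<and> D' \<inter> {..<m} = D" if "E m D" for m D
  proof (rule ccontr)
    assume neg: "\<not> ?thesis"
    let ?S = "{D'. D' \<subseteq> {..<Suc m} \<and> D' \<inter> {..<m} = D}"
    have fin: "finite ?S" by simp
    have "\<forall>D'\<in>?S. \<exists>k. Suc m \<le> k \<and> (\<forall>D''. D'' \<inter> {..<Suc m} = D' \<longrightarrow> \<not> Q k D'')"
    proof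
      fix D' assume D': "D' \<in> ?S"
      then have "\<not> E (Suc m) D'" using neg by blast
      then show "\<exists>k. Suc m \<le> k \<and> (\<forall>D''. D'' \<inter> {..<Suc m} = D' \<longrightarrow> \<not> Q k D'')"
        using D' unfolding E_def by simp
    qed
    from bchoice[OF this] obtain b where
      "\<forall>D'\<in>?S. Suc m \<le> b D' \<and> (\<forall>D''. D'' \<inter> {..<Suc m} = D' \<longrightarrow> \<not> Q (b D') D'')"
      by blast
    then have b: "\<And>D'. D' \<in> ?S \<Longrightarrow> Suc m \<le> b D'"
      "\<And>D' D''. D' \<in> ?S \<Longrightarrow> D'' \<inter> {..<Suc m} = D' \<Longrightarrow> \<not> Q (b D') D''"
      by blast+
    \<comment> \<open>Each child \<open>D'\<close> of \<open>D\<close> has no extension at level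
      \<open>b D'\<close>. Yet \<open>E m D\<close> provides an extension of \<open>D\<close> at
      level \<open>max m c\<close>, and its truncation extends one of these children.\<close>
    define c where "c = Max (b ` ?S)"
    have c: "b D' \<le> c" if "D' \<in> ?S" for D'
      unfolding c_def using fin that by (intro Max_ge finite_imageI imageI)
    have "m \<le> max m c" by simp
    with \<open>E m D\<close> obtain D0 where D0: "D0 \<inter> {..<m} = D" "Q (max m c) D0"
      unfolding E_def by blast
    let ?D' = "D0 \<inter> {..<Suc m}"
    have S: "?D' \<in> ?S" using D0(1) by auto
    have "Q (b ?D') (D0 \<inter> {..<b ?D'})"
      using is_treeD[OF tree _ D0(2)] c[OF S] by simp
    moreover have "(D0 \<inter> {..<b ?D'}) \<inter> {..<Suc m} = ?D'" using b(1)[OF S] by auto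
    ultimately show False using b(2)[OF S] by blast
  qed
  moreover have "E 0 {}" using ex by (auto simp: E_def)
  ultimately have "\<exists>S. \<forall>m. E m (S m) \<and> S (Suc m) \<inter> {..<m} = S m"
    by (intro dependent_nat_choice) auto
  then obtain S where S: "\<And>m. E m (S m)" "\<And>m. S (Suc m) \<inter> {..<m} = S m"
    by auto
  have sub: "S m \<subseteq> {..<m}" for m
    using S(1)[of m] unfolding E_def by (rule conjunct1)
  have mono: "S m' \<inter> {..<m} = S m" if "m \<le> m'" for m m'
    using that
  proof (induction rule: dec_induct)
    case base
    show ?case using sub[of m] by (rule Int_absorb2)
  next
    case (step i)
    have "S (Suc i) \<inter> {..<m} = (S (Suc i) \<inter> {..<i}) \<inter> {..<m}" using step.hyps by auto
    then show ?case unfolding S(2) step.IH .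
  qed
  have "(\<Union>m. S m) \<inter> {..<m} = S m" for m
  proof
    show "(\<Union>m. S m) \<inter> {..<m} \<subseteq> S m"
    proof
      fix x assume x: "x \<in> (\<Union>m. S m) \<inter> {..<m}"
      then obtain i where "x \<in> S i" by blast
      then have "x \<in> S (max i m) \<inter> {..<i}" by (simp only: mono[OF max.cobounded1])
      with x have "x \<in> S (max i m) \<inter> {..<m}" by simp
      then show "x \<in> S m" by (simp only: mono[OF max.cobounded2])
    qed
    show "S m \<subseteq> (\<Union>m. S m) \<inter> {..<m}" using sub[of m] by blast
  qed
  moreover have "Q m (S m)" for m
  proof -
    have "\<exists>D'. D' \<inter> {..<m} = S m \<and> Q m D'" using S(1)[of m] unfolding E_def by simp
    then obtain D' where D': "D' \<inter> {..<m} = S m" "Q m D'" by (elim exE conjE)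
    show ?thesis using is_treeD[OF tree order_refl D'(2)] unfolding D'(1) .
  qed
  ultimately have "(\<Union>m. S m) \<in> paths Q" by (simp add: paths_def)
  then show ?thesis by blast
qed

text \<open>This is compactness for a decreasing sequence of closed sets. One tree has the
  intersection as its paths: level \<open>m\<close> imposes the trees with index at most
  \<open>m\<close>, and a path of \<open>Q m\<close> passes through that level.\<close>

lemma paths_INT_nonempty:
  assumes tree: "\<And>e. is_tree (Q e)" and ne: "\<And>e. paths (Q e) \<noteq> {}"
    and dec: "\<And>e. paths (Q (Suc e)) \<subseteq> paths (Q e)"
  shows "(\<Inter>e. paths (Q e)) \<noteq> {}"
proof -
  let ?R = "\<lambda>m D. \<forall>e\<le>m. Q e m D"
  have "is_tree ?R"
    unfolding is_tree_def by (auto intro: is_treeD[OF tree])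
  moreover have "\<exists>D. D \<subseteq> {..<m} \<and> ?R m D" for m
  proof -
    obtain X where X: "X \<in> paths (Q m)" using ne by blast
    have "X \<in> paths (Q e)" if "e \<le> m" for e
      using X lift_Suc_antimono_le[of "\<lambda>e. paths (Q e)", OF dec that] by blast
    then show ?thesis by (intro exI[of _ "X \<inter> {..<m}"]) (auto simp: paths_def)
  qed
  ultimately obtain X where X: "X \<in> paths ?R" using koenig by blast
  have "Q e m (X \<inter> {..<m})" for e m
  proof -
    \<comment> \<open>Condition \<open>e\<close> is in force only from level \<open>e\<close> on, so
      lower levels are reached by truncation.\<close>
    have "Q e (max e m) (X \<inter> {..<max e m})" using X by (simp add: paths_def)
    then have "Q e m ((X \<inter> {..<max e m}) \<inter> {..<m})"
      by (rule is_treeD[OF tree max.cobounded2])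
    moreover have "(X \<inter> {..<max e m}) \<inter> {..<m} = X \<inter> {..<m}" by auto
    ultimately show ?thesis by simp
  qed
  then have "X \<in> paths (Q e)" for e by (simp add: paths_def)
  then show ?thesis by blast
qed

section \<open>Thinning out decidable trees\<close>

definition decidable_tree :: "(nat \<Rightarrow> nat) \<Rightarrow> (nat \<Rightarrow> nat set \<Rightarrow> bool) \<Rightarrow> bool" where
  "decidable_tree h Q \<longleftrightarrow> is_tree Q \<and> paths Q \<noteq> {} \<and>
     decides h (\<lambda>z. Q (fst (prod_decode z)) (set_decode (snd (prod_decode z))))"

lemma decides_tree:
  assumes "decidable_tree h Q" "computes h M" "computes h D"
  shows "decides h (\<lambda>z. Q (M z) (set_decode (D z)))"
  using assms decides_comp[of h "\<lambda>z. Q (fst (prod_decode z)) (set_decode (snd (prod_decode z)))",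
      OF _ computes_prod_encode[OF assms(2,3)]]
  by (simp add: decidable_tree_def)

text \<open>Convergence on a truncated oracle persists on the longer one, so divergence passes to
  initial segments.\<close>

lemma is_tree_diverging:
  assumes "is_tree Q"
  shows "is_tree (\<lambda>m D. Q m D \<and> fuel_run m D t x = None)"
  unfolding is_tree_def
proof (intro allI impI conjI)
  fix m m' D assume "m \<le> m'" and D: "Q m' D \<and> fuel_run m' D t x = None"
  then show "Q m (D \<inter> {..<m})" using is_treeD[OF assms] by blast
  show "fuel_run m (D \<inter> {..<m}) t x = None"
    using fuel_run_mono[OF _ \<open>m \<le> m'\<close> refl, of D t x] D by (cases "fuel_run m (D \<inter> {..<m}) t x") auto
qed

text \<open>Divergence at \<open>x\<close> is a closed condition on the oracle, since convergence
  shows at a finite level. Hence it can be imposed by pruning a tree.\<close>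

lemma full_run_eq_None_iff:
  "full_run X t x = None \<longleftrightarrow> (\<forall>m. fuel_run m (X \<inter> {..<m}) t x = None)"
proof
  assume X: "full_run X t x = None"
  show "\<forall>m. fuel_run m (X \<inter> {..<m}) t x = None"
  proof (rule allI, rule ccontr)
    fix m assume "fuel_run m (X \<inter> {..<m}) t x \<noteq> None"
    then obtain v where "fuel_run m (X \<inter> {..<m}) t x = Some v" by auto
    from fuel_run_sound[OF this] X show False by simp
  qed
next
  assume X: "\<forall>m. fuel_run m (X \<inter> {..<m}) t x = None"
  show "full_run X t x = None"
  proof (rule ccontr)
    assume "full_run X t x \<noteq> None"
    then obtain v where "full_run X t x = Some v" by auto
    from eventually_happens'[OF sequentially_bot eventually_fuel_run[OF this]] X show False by simp
  qed
qed

lemma paths_diverging: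
  "paths (\<lambda>m D. Q m D \<and> fuel_run m D t x = None) = {X \<in> paths Q. full_run X t x = None}"
  by (simp add: paths_def full_run_eq_None_iff set_eq_iff all_conj_distrib)

text \<open>Otherwise the nodes on which \<open>t\<close> has not converged would form a tree with
  nodes at every level, and \<open>koenig\<close> would give a path on which \<open>t\<close>
  diverges at \<open>x\<close>.\<close>

lemma ex_level_converges:
  assumes "is_tree Q" and "\<And>X. X \<in> paths Q \<Longrightarrow> full_run X t x \<noteq> None"
  shows "\<exists>m. \<forall>d<2 ^ m. Q m (set_decode d) \<longrightarrow> fuel_run m (set_decode d) t x \<noteq> None"
proof (rule ccontr)
  assume neg: "\<not> ?thesis"
  let ?R = "\<lambda>m D. Q m D \<and> fuel_run m D t x = None"
  have "is_tree ?R"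
    by (rule is_tree_diverging[OF assms(1)])
  moreover have "\<exists>D. D \<subseteq> {..<m} \<and> ?R m D" for m
  proof -
    from neg obtain d where "d < 2 ^ m" "?R m (set_decode d)" by auto
    then show ?thesis using set_decode_subset_lessThan by (intro exI[of _ "set_decode d"]) simp
  qed
  ultimately have "paths ?R \<noteq> {}" by (rule koenig)
  then show False unfolding paths_diverging using assms(2) by blast
qed

lemma computes_uniform_bound:
  assumes Q: "decidable_tree h Q" and conv: "\<And>X x. X \<in> paths Q \<Longrightarrow> full_run X t x \<noteq> None"
  shows "\<exists>b. computes h b \<and> (\<forall>X\<in>paths Q. \<forall>x v. full_run X t x = Some v \<longrightarrow> v \<le> b x)"
proof -
  let ?P = "\<lambda>x m. \<forall>d<2 ^ m. Q m (set_decode d) \<longrightarrow>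
     \<not> opt_code (fuel_run m (set_decode d) t x) = 0"
  define L where "L x = (LEAST m. ?P x m)" for x
  have ex: "\<exists>m. ?P x m" for x
    using ex_level_converges[of Q t x] Q conv by (simp add: decidable_tree_def)
  then have L: "?P x (L x)" for x
    unfolding L_def by (rule LeastI_ex)
  have cL: "computes h (\<lambda>x. L (F x))" if "computes h F" for F
    unfolding L_def
    by (intro computes_Least ex computes_intros decides_tree[OF Q] that)
  \<comment> \<open>Summing over all indices of that level, even off the tree, only enlarges the
    bound, and a divergent run contributes zero.\<close>
  define b where "b x = (\<Sum>d<2 ^ L x. opt_code (fuel_run (L x) (set_decode d) t x))" for x
  have "computes h b"
    unfolding b_def by (intro computes_intros cL)
  moreover have "v \<le> b x" if X: "X \<in> paths Q" and v: "full_run X t x = Some v" for X x v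
  proof -
    let ?D = "X \<inter> {..<L x}"
    have d: "set_encode ?D < 2 ^ L x" by (rule set_encode_less) simp
    have "Q (L x) (set_decode (set_encode ?D))" using X by (simp add: paths_def)
    then have "fuel_run (L x) ?D t x \<noteq> None" using L[of x, rule_format, OF d] by simp
    then have "fuel_run (L x) ?D t x = Some v"
      using fuel_run_sound[of "L x" X t x] v by auto
    then have "Suc v = opt_code (fuel_run (L x) (set_decode (set_encode ?D)) t x)"
      by simp
    also have "\<dots> \<le> b x"
      unfolding b_def using d by (intro member_le_sum) auto
    finally show ?thesis by simp
  qed
  ultimately show ?thesis by blast
qed

lemma thin_tree:
  assumes Q: "decidable_tree h Q" and nodom: "\<forall>u. computes h u \<longrightarrow> \<not> dominates u g"
  shows "\<exists>Q'. decidable_tree h Q' \<and> paths Q' \<subseteq> paths Q \<and>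
    (\<forall>X\<in>paths Q'. \<forall>u. full_run X t = (\<lambda>x. Some (u x)) \<longrightarrow> \<not> dominates u g)"
proof (cases "\<exists>X\<in>paths Q. \<exists>x. full_run X t x = None")
  case True
  then obtain X x where X: "X \<in> paths Q" "full_run X t x = None" by blast
  \<comment> \<open>The choice of the case and of \<open>x\<close> is not effective. Each tree only
    has to be decidable from \<open>h\<close>, so \<open>x\<close> may be built into its decision
    procedure.\<close>
  let ?Q = "\<lambda>m D. Q m D \<and> fuel_run m D t x = None"
  have "is_tree ?Q"
    using Q unfolding decidable_tree_def by (blast intro: is_tree_diverging)
  moreover have "paths ?Q \<noteq> {}"
    using X unfolding paths_diverging by auto
  moreover have "decides h (\<lambda>z. Q (fst (prod_decode z)) (set_decode (snd (prod_decode z))) \<and>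
      opt_code (fuel_run (fst (prod_decode z)) (set_decode (snd (prod_decode z))) t x) = 0)"
    by (intro computes_intros decides_tree[OF Q])
  ultimately have "decidable_tree h ?Q"
    unfolding decidable_tree_def by simp
  moreover have "full_run Y t \<noteq> (\<lambda>x. Some (u x))" if "Y \<in> paths ?Q" for Y u
  proof
    assume eq: "full_run Y t = (\<lambda>x. Some (u x))"
    from that have "full_run Y t x = None" unfolding paths_diverging by simp
    then show False unfolding eq by simp
  qed
  moreover have "paths ?Q \<subseteq> paths Q" unfolding paths_diverging by simp
  ultimately show ?thesis by (intro exI[of _ ?Q]) simp
next
  case False
  then obtain b where b: "computes h b"
    "\<forall>X\<in>paths Q. \<forall>x v. full_run X t x = Some v \<longrightarrow> v \<le> b x"
    using computes_uniform_bound[OF Q, of t] by auto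
  have "\<not> dominates u g" if "X \<in> paths Q" "full_run X t = (\<lambda>x. Some (u x))" for X u
  proof
    assume "dominates u g"
    moreover have "u x \<le> b x" for x using b(2) that by simp
    ultimately have "dominates b g" unfolding dominates_def by (meson order_trans)
    with nodom b(1) show False by blast
  qed
  with Q show ?thesis by (intro exI[of _ Q]) simp
qed

lemma ex_path_not_dominating:
  assumes Q: "decidable_tree h Q" and nodom: "\<forall>u. computes h u \<longrightarrow> \<not> dominates u g"
  shows "\<exists>X\<in>paths Q. \<forall>u. set_computes X u \<longrightarrow> \<not> dominates u g"
proof -
  let ?avoids = "\<lambda>Q e. \<forall>X\<in>paths Q. \<forall>u. full_run X (from_nat e) = (\<lambda>x. Some (u x)) \<longrightarrow> \<not> dominates u g"
  \<comment> \<open>Stage \<open>e\<close> deals with the program \<open>from_nat e\<close>. The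
    clause for \<open>e = 0\<close> pins the start of the sequence to \<open>Q\<close> inside the
    invariant.\<close>
  have "\<exists>R. \<forall>e. (decidable_tree h (R e) \<and> (e = 0 \<longrightarrow> R e = Q)) \<and>
      (paths (R (Suc e)) \<subseteq> paths (R e) \<and> ?avoids (R (Suc e)) e)"
  proof (rule dependent_nat_choice)
    show "\<exists>Q'. decidable_tree h Q' \<and> ((0::nat) = 0 \<longrightarrow> Q' = Q)" using Q by blast
  next
    fix Q' and e :: nat assume "decidable_tree h Q' \<and> (e = 0 \<longrightarrow> Q' = Q)"
    from thin_tree[OF conjunct1[OF this] nodom, of "from_nat e"]
    obtain Q'' where "decidable_tree h Q''" "paths Q'' \<subseteq> paths Q'" "?avoids Q'' e"
      by (elim exE conjE) auto
    then show "\<exists>Q''. (decidable_tree h Q'' \<and> (Suc e = 0 \<longrightarrow> Q'' = Q)) \<and>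
        (paths Q'' \<subseteq> paths Q' \<and> ?avoids Q'' e)"
      by (intro exI[of _ Q'']) simp
  qed
  then obtain R where step: "\<forall>e. (decidable_tree h (R e) \<and> (e = 0 \<longrightarrow> R e = Q)) \<and>
      (paths (R (Suc e)) \<subseteq> paths (R e) \<and> ?avoids (R (Suc e)) e)" ..
  have R: "decidable_tree h (R e)" "R 0 = Q" "paths (R (Suc e)) \<subseteq> paths (R e)"
    "?avoids (R (Suc e)) e" for e
    using step[rule_format, of e] step[rule_format, of 0] by simp_all
  obtain X where X: "\<And>e. X \<in> paths (R e)"
    using paths_INT_nonempty[of R, OF _ _ R(3)] R(1) unfolding decidable_tree_def by auto
  have "\<not> dominates u g" if "set_computes X u" for u
  proof -
    have "partial_recursive_in (indicator X) (\<lambda>x. Some (u x))"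
      using that unfolding set_computes_def computes_def .
    from partial_recursive_in_imp_run[OF this] obtain t where "full_run X t = (\<lambda>x. Some (u x))" ..
    \<comment> \<open>The program \<open>t\<close> is dealt with in passing to the tree with index
      \<open>Suc (to_nat t)\<close>, which also has \<open>X\<close> as a path.\<close>
    then show ?thesis using R(4)[of "to_nat t"] X[of "Suc (to_nat t)"] by simp
  qed
  moreover have "X \<in> paths Q" using X[of 0] R(2) by simp
  ultimately show ?thesis by blast
qed

section \<open>The tree of sparse homogeneous sets\<close>

text \<open>\<open>i < card (D \<inter> {..h i})\<close> expresses that element number
  \<open>i\<close>, counted from 0, exists and is at most \<open>h i\<close>. It is demanded only if
  \<open>h i < m\<close>, when a node of length \<open>m\<close> already settles it, and
  \<open>i < m\<close> keeps the quantifier bounded. Along a path every such demand takes effect at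
  some level.\<close>

definition coloring_tree ::
  "nat \<Rightarrow> (nat set \<Rightarrow> nat) \<Rightarrow> nat set \<Rightarrow> (nat \<Rightarrow> nat) \<Rightarrow> nat \<Rightarrow> nat set \<Rightarrow> bool" where
  "coloring_tree n f C h m D \<longleftrightarrow>
     (\<forall>i<m. h i < m \<longrightarrow> i < card (D \<inter> {..h i})) \<and> f ` [D]\<^bsup>n\<^esup> \<subseteq> C"

lemma is_tree_coloring_tree: "is_tree (coloring_tree n f C h)"
  unfolding is_tree_def
proof (intro allI impI)
  fix m m' D assume m: "m \<le> m'" and Q: "coloring_tree n f C h m' D"
  have "D \<inter> {..<m} \<inter> {..h i} = D \<inter> {..h i}" if "h i < m" for i
    using that by auto
  moreover have "[D \<inter> {..<m}]\<^bsup>n\<^esup> \<subseteq> [D]\<^bsup>n\<^esup>" by (rule nsets_mono) auto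
  ultimately show "coloring_tree n f C h m (D \<inter> {..<m})"
    using m Q unfolding coloring_tree_def by (auto 0 3)
qed

lemma decides_coloring_tree:
  assumes "computable_coloring n k f" and "finite C"
  shows "decides h (\<lambda>z. coloring_tree n f C h (fst (prod_decode z)) (set_decode (snd (prod_decode z))))"
proof -
  obtain r where r: "computable r" "\<And>s. s \<in> [UNIV]\<^bsup>n\<^esup> \<Longrightarrow> f s = r (set_encode s)"
    using assms(1) unfolding computable_coloring_def by blast
  have r_intro: "computes h (\<lambda>z. r (F z))" if "computes h F" for F
    using computes_comp[OF computes_mono that] r(1) by (simp add: computable_def)
  have card: "card (set_decode d \<inter> {..b}) = (\<Sum>i<Suc b. of_bool (i \<in> set_decode d))" for d b
    by (simp add: of_bool_def sum.If_cases Int_def lessThan_Suc_atMost conj_commute)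
  have card': "card (set_decode d) = (\<Sum>i<Suc d. of_bool (i \<in> set_decode d))" for d
  proof -
    have "set_decode d \<inter> {..d} = set_decode d"
      using less_of_mem_set_decode by (auto intro: less_imp_le)
    then show ?thesis using card[of d d] by simp
  qed
  \<comment> \<open>\<open>set_encode\<close> is monotone under inclusion, so the subsets of
    \<open>set_decode d\<close> have indices at most \<open>d\<close>, and the elements of
    \<open>set_decode c\<close> are below \<open>c\<close>. All quantifiers become bounded.\<close>
  have colors: "f ` [set_decode d]\<^bsup>n\<^esup> \<subseteq> C \<longleftrightarrow> (\<forall>c<Suc d.
      (\<forall>i<c. i \<in> set_decode c \<longrightarrow> i \<in> set_decode d) \<and>
      (\<Sum>i<Suc c. of_bool (i \<in> set_decode c)) = n \<longrightarrow> r c \<in> C)" (is "_ \<longleftrightarrow> ?R") for d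
  proof
    assume L: "f ` [set_decode d]\<^bsup>n\<^esup> \<subseteq> C"
    show ?R
    proof (intro allI impI)
      fix c assume "c < Suc d" and c: "(\<forall>i<c. i \<in> set_decode c \<longrightarrow> i \<in> set_decode d) \<and>
        (\<Sum>i<Suc c. of_bool (i \<in> set_decode c)) = n"
      have "set_decode c \<in> [set_decode d]\<^bsup>n\<^esup>"
        using c less_of_mem_set_decode unfolding card'[symmetric] by (auto simp: nsets_def)
      then have "f (set_decode c) \<in> C" using L by blast
      moreover have "f (set_decode c) = r (set_encode (set_decode c))"
        using \<open>set_decode c \<in> _\<close> by (intro r(2)) (auto simp: nsets_def)
      ultimately show "r c \<in> C" by simp
    qed
  next
    assume R: ?R
    have R': "r c \<in> C" if "c < Suc d" "\<forall>i<c. i \<in> set_decode c \<longrightarrow> i \<in> set_decode d"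
      "card (set_decode c) = n" for c
      using R that unfolding card'[symmetric] by blast
    have "f s \<in> C" if s: "s \<in> [set_decode d]\<^bsup>n\<^esup>" for s
    proof -
      have s': "finite s" "s \<subseteq> set_decode d" "card s = n" using s by (auto simp: nsets_def)
      then have "set_encode s \<le> set_encode (set_decode d)"
        unfolding set_encode_def by (intro sum_mono2) auto
      then have "r (set_encode s) \<in> C"
        using s' by (intro R') auto
      then show ?thesis using r(2)[of s] s' by (simp add: nsets_def)
    qed
    then show "f ` [set_decode d]\<^bsup>n\<^esup> \<subseteq> C" by blast
  qed
  show ?thesis
    unfolding coloring_tree_def card colors
    by (intro computes_intros computes_query r_intro decides_mem_finite assms(2))
qed

lemma mem_paths_coloring_tree:
  assumes "infinite H" and "dominates h (principal_function H)" and "f ` [H]\<^bsup>n\<^esup> \<subseteq> C"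
  shows "H \<in> paths (coloring_tree n f C h)"
proof -
  have "i < card (H \<inter> {..<m} \<inter> {..h i})" if "h i < m" for i m
  proof -
    \<comment> \<open>The first \<open>i + 1\<close> elements of \<open>H\<close> are at most
      \<open>enumerate H i\<close>, hence at most \<open>h i\<close>.\<close>
    have "enumerate H ` {..i} \<subseteq> H \<inter> {..<m} \<inter> {..h i}"
    proof clarify
      fix j assume "j \<le> i"
      then have "enumerate H j \<le> enumerate H i"
        using enumerate_mono_le_iff[OF assms(1)] by blast
      also have "\<dots> \<le> h i"
        using assms(2) by (simp add: dominates_def principal_function_def)
      finally show "enumerate H j \<in> H \<inter> {..<m} \<inter> {..h i}"
        using that enumerate_in_set[OF assms(1)] by auto
    qed
    then have "card (enumerate H ` {..i}) \<le> card (H \<inter> {..<m} \<inter> {..h i})"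
      by (intro card_mono) auto
    moreover have "card (enumerate H ` {..i}) = Suc i"
      using inj_enumerate[OF assms(1)] by (simp add: card_image inj_on_subset)
    ultimately show ?thesis by simp
  qed
  moreover have "f ` [H \<inter> {..<m}]\<^bsup>n\<^esup> \<subseteq> C" for m
    using assms(3) nsets_mono[of "H \<inter> {..<m}" H n] by blast
  ultimately show ?thesis by (simp add: paths_def coloring_tree_def)
qed

lemma paths_coloring_treeD:
  assumes "X \<in> paths (coloring_tree n f C h)"
  shows "infinite X" and "f ` [X]\<^bsup>n\<^esup> \<subseteq> C"
proof -
  have *: "\<forall>i<m. h i < m \<longrightarrow> i < card (X \<inter> {..<m} \<inter> {..h i})" "f ` [X \<inter> {..<m}]\<^bsup>n\<^esup> \<subseteq> C" for m
    using assms by (auto simp: paths_def coloring_tree_def)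
  show "infinite X"
  proof
    assume X: "finite X"
    \<comment> \<open>This level exceeds both \<open>card X\<close> and \<open>h (card X)\<close>,
      so the demand with index \<open>card X\<close> is in force and asks for more elements than
      \<open>X\<close> has.\<close>
    let ?m = "Suc (max (card X) (h (card X)))"
    have "card X < card (X \<inter> {..<?m} \<inter> {..h (card X)})"
      using *(1)[of ?m] by simp
    also have "\<dots> \<le> card X" by (intro card_mono X) auto
    finally show False by simp
  qed
  have "f s \<in> C" if "s \<in> [X]\<^bsup>n\<^esup>" for s
  proof -
    have s: "finite s" "s \<subseteq> X" "card s = n" using that by (auto simp: nsets_def)
    \<comment> \<open>The color of a finite set is controlled at any level that bounds the
      set.\<close>
    obtain m where "s \<subseteq> {..<m}" using s(1) finite_nat_bounded by blast
    then have "s \<in> [X \<inter> {..<m}]\<^bsup>n\<^esup>" using s by (auto simp: nsets_def)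
    then show ?thesis using *(2)[of m] by blast
  qed
  then show "f ` [X]\<^bsup>n\<^esup> \<subseteq> C" by blast
qed

theorem theorem2p8:
  fixes g :: "nat \<Rightarrow> nat" and n l k :: nat and f :: "nat set \<Rightarrow> nat"
  assumes "n \<ge> 1" and "l \<ge> 1"
    and "computable_coloring n k f"
    and "\<And>H. infinite H \<Longrightarrow> card (f ` [H]\<^bsup>n\<^esup>) \<le> l \<Longrightarrow>
           \<exists>u. set_computes H u \<and> dominates u g"
  shows "\<forall>H. infinite H \<longrightarrow> card (f ` [H]\<^bsup>n\<^esup>) \<le> l \<longrightarrow>
           domination_modulus (principal_function H) g"
  unfolding domination_modulus_def
proof (intro allI impI, rule ccontr)
  fix H h
  assume H: "infinite H" "card (f ` [H]\<^bsup>n\<^esup>) \<le> l" and h: "dominates h (principal_function H)"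
    and "\<nexists>u. computes h u \<and> dominates u g"
  then have nodom: "\<forall>u. computes h u \<longrightarrow> \<not> dominates u g" by blast
  \<comment> \<open>Allowing exactly the colors used by \<open>H\<close> gives every path at most
    \<open>l\<close> colors. This finite set is the only information about \<open>H\<close> that
    enters the decision procedure for the tree.\<close>
  let ?C = "f ` [H]\<^bsup>n\<^esup>"
  let ?Q = "coloring_tree n f ?C h"
  have "?C \<subseteq> {..<k}"
    using assms(3) nsets_mono[of H UNIV n] unfolding computable_coloring_def by blast
  then have C: "finite ?C" by (rule finite_subset) simp
  have "H \<in> paths ?Q" using mem_paths_coloring_tree[OF H(1) h] by blast
  then have "decidable_tree h ?Q"
    using is_tree_coloring_tree decides_coloring_tree[OF assms(3) C]
    unfolding decidable_tree_def by blast
  then obtain X where X: "X \<in> paths ?Q" "\<And>u. set_computes X u \<Longrightarrow> \<not> dominates u g"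
    using ex_path_not_dominating[OF _ nodom] by blast
  have "card (f ` [X]\<^bsup>n\<^esup>) \<le> l"
    using card_mono[OF C paths_coloring_treeD(2)[OF X(1)]] H(2) by simp
  with assms(4)[OF paths_coloring_treeD(1)[OF X(1)]] X(2) show False by blast
qed

end
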